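(* Let $\mathfrak{g}=\mathfrak{g}_{\bar 0}+\mathfrak{g}_{\bar 1}$ be a real Lie superalgebra with $\mathfrak{g}_{\bar 0}$ reductive, $\mathfrak{g}_{\bar 0}=\mathfrak{k}_0\oplus\mathfrak{k}_1\oplus\cdots\oplus\mathfrak{k}_s$ with $\mathfrak{k}_0$ Abelian and $\mathfrak{k}_1,\dots,\mathfrak{k}_s$ simple ideals. Let $\mathbf{B}$ be a bi-invariant metric on $\mathfrak{g}$, let $x_0,\dots,x_s\in\mathbb{R}\setminus\{0\}$, and let $$\langle\cdot,\cdot\rangle=x_0\mathbf{B}|_{\mathfrak{k}_0}+x_1\mathbf{B}|_{\mathfrak{k}_1}+\cdots+x_s\mathbf{B}|_{\mathfrak{k}_s}+\mathbf{B}|_{\mathfrak{g}_{\bar 1}}.$$ Then the Levi-Civita connection $\nabla$ of $(\mathfrak{g},\langle\cdot,\cdot\rangle)$ is given, for $0\le i,j\le s$, by $$\nabla_XY=\begin{cases}\frac12[X,Y], & X\in\mathfrak{k}_i,\ Y\in\mathfrak{k}_j;\\ \frac12[X,Y], & X,Y\in\mathfrak{g}_{\bar 1};\\ \left(1-\frac{x_i}{2}\right)[X,Y], & X\in\mathfrak{k}_i,\ Y\in\mathfrak{g}_{\bar 1};\\ \frac{x_i}{2}[X,Y], & X\in\mathfrak{g}_{\bar 1},\ Y\in\mathfrak{k}_i.\end{cases}$$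
   Context: Lie superalgebras are finite dimensional with $\mathfrak{g}_{\bar 1}\ne 0$; $[X]\in\mathbb{Z}_2$ denotes the parity of a homogeneous element $X$, and formulas are written for homogeneous elements. The bracket satisfies $[X,Y]=-(-1)^{[X][Y]}[Y,X]$ and $[X,[Y,Z]]=[[X,Y],Z]+(-1)^{[X][Y]}[Y,[X,Z]]$. A metric on $\mathfrak{g}$ is a non-degenerate bilinear form $f$ that is even ($f(\mathfrak{g}_{\bar 0},\mathfrak{g}_{\bar 1})=0$) and supersymmetric ($f(X,Y)=(-1)^{[X][Y]}f(Y,X)$). It is bi-invariant if $f([X,Y],Z)=f(X,[Y,Z])$ for all $X,Y,Z$. For a bi-invariant metric $\mathbf{B}$ the ideals $\mathfrak{k}_0,\dots,\mathfrak{k}_s$ are pairwise $\mathbf{B}$-orthogonal and each $\mathbf{B}|_{\mathfrak{k}_i}$ is non-degenerate. In the metric $\langle\cdot,\cdot\rangle$, the spaces $\mathfrak{k}_0,\dots,\mathfrak{k}_s,\mathfrak{g}_{\bar 1}$ are pairwise orthogonal. The Levi-Civita connection $\nabla$ of a metric $\langle\cdot,\cdot\rangle$ is the unique even bilinear map $\mathfrak{g}\times\mathfrak{g}\to\mathfrak{g}$ with $\langle\nabla_XY,Z\rangle+(-1)^{[X][Y]}\langle Y,\nabla_XZ\rangle=0$ and $\nabla_XY-(-1)^{[X][Y]}\nabla_YX=[X,Y]$. *)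

theory Defs
  imports "HOL-Analysis.Analysis" "HOL-Library.Z2"
begin

text \<open>
  A superspace is a type \<open>'a :: real_vector\<close> together with a grading
  \<open>G :: bit \<Rightarrow> 'a set\<close>, where \<open>bit\<close> is the field with two elements: \<open>G 0\<close> is the even part
  and \<open>G 1\<close> the odd part. Identities for homogeneous elements are quantified over the degrees
  \<open>p\<close>, \<open>q\<close> and over elements of \<open>G p\<close>, \<open>G q\<close>; thus \<open>0\<close> is homogeneous of both degrees.
\<close>

definition koszul_sign :: "bit \<Rightarrow> bit \<Rightarrow> real" where
  "koszul_sign p q = (if p = 1 \<and> q = 1 then - 1 else 1)"

definition direct_sum_of :: "'a::real_vector set \<Rightarrow> 'i set \<Rightarrow> ('i \<Rightarrow> 'a set) \<Rightarrow> bool" where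
  "direct_sum_of V I W \<longleftrightarrow>
     (\<forall>i\<in>I. subspace (W i)) \<and>
     V = span (\<Union>i\<in>I. W i) \<and>
     (\<forall>i\<in>I. W i \<inter> span (\<Union>j\<in>I - {i}. W j) = {0})"

text \<open>
  The component of \<open>v\<close> in the \<open>i\<close>-th summand; meaningful only if \<open>v\<close> lies in the direct sum
  of the \<open>W j\<close>, \<open>j \<in> I\<close>.
\<close>

definition component :: "'i set \<Rightarrow> ('i \<Rightarrow> 'a::real_vector set) \<Rightarrow> 'i \<Rightarrow> 'a \<Rightarrow> 'a" where
  "component I W i v = (THE u. u \<in> W i \<and> v - u \<in> span (\<Union>j\<in>I - {i}. W j))"

locale lie_superalgebra =
  fixes G :: "bit \<Rightarrow> 'a::real_vector set"
    and br :: "'a \<Rightarrow> 'a \<Rightarrow> 'a"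
  assumes finite_dimensional: "\<exists>S::'a set. finite S \<and> span S = UNIV"
    and grading: "direct_sum_of UNIV UNIV G"
    and odd_nonzero: "G 1 \<noteq> {0}"
    and bilinear_br: "bilinear br"
    and br_degree: "\<And>p q X Y. X \<in> G p \<Longrightarrow> Y \<in> G q \<Longrightarrow> br X Y \<in> G (p + q)"
    and super_skew: "\<And>p q X Y. X \<in> G p \<Longrightarrow> Y \<in> G q \<Longrightarrow>
          br X Y = - koszul_sign p q *\<^sub>R br Y X"
    and super_jacobi: "\<And>p q r X Y Z. X \<in> G p \<Longrightarrow> Y \<in> G q \<Longrightarrow> Z \<in> G r \<Longrightarrow>
          br X (br Y Z) = br (br X Y) Z + koszul_sign p q *\<^sub>R br Y (br X Z)"

text \<open>
  The next four notions are applied to subspaces \<open>h\<close> of the even part, on which \<open>br\<close> is an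
  ordinary Lie bracket; hence one-sided ideals are two-sided.
\<close>

definition lie_ideal :: "('a::real_vector \<Rightarrow> 'a \<Rightarrow> 'a) \<Rightarrow> 'a set \<Rightarrow> 'a set \<Rightarrow> bool" where
  "lie_ideal br h a \<longleftrightarrow> subspace a \<and> a \<subseteq> h \<and> (\<forall>X\<in>h. \<forall>Y\<in>a. br X Y \<in> a)"

definition lie_abelian :: "('a::real_vector \<Rightarrow> 'a \<Rightarrow> 'a) \<Rightarrow> 'a set \<Rightarrow> bool" where
  "lie_abelian br h \<longleftrightarrow> (\<forall>X\<in>h. \<forall>Y\<in>h. br X Y = 0)"

definition lie_simple :: "('a::real_vector \<Rightarrow> 'a \<Rightarrow> 'a) \<Rightarrow> 'a set \<Rightarrow> bool" where
  "lie_simple br h \<longleftrightarrow> \<not> lie_abelian br h \<and> (\<forall>a. lie_ideal br h a \<longrightarrow> a = {0} \<or> a = h)"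

text \<open>Reductive: the adjoint representation is completely reducible.\<close>

definition lie_reductive :: "('a::real_vector \<Rightarrow> 'a \<Rightarrow> 'a) \<Rightarrow> 'a set \<Rightarrow> bool" where
  "lie_reductive br h \<longleftrightarrow>
     (\<forall>a. lie_ideal br h a \<longrightarrow>
        (\<exists>b. lie_ideal br h b \<and> a \<inter> b = {0} \<and> h = {X + Y | X Y. X \<in> a \<and> Y \<in> b}))"

definition super_metric :: "(bit \<Rightarrow> 'a::real_vector set) \<Rightarrow> ('a \<Rightarrow> 'a \<Rightarrow> real) \<Rightarrow> bool" where
  "super_metric G f \<longleftrightarrow>
     bilinear f \<and>
     (\<forall>X. (\<forall>Y. f X Y = 0) \<longrightarrow> X = 0) \<and>
     (\<forall>X\<in>G 0. \<forall>Y\<in>G 1. f X Y = 0) \<and>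
     (\<forall>p q. \<forall>X\<in>G p. \<forall>Y\<in>G q. f X Y = koszul_sign p q * f Y X)"

definition bi_invariant :: "('a \<Rightarrow> 'a \<Rightarrow> 'a) \<Rightarrow> ('a \<Rightarrow> 'a \<Rightarrow> real) \<Rightarrow> bool" where
  "bi_invariant br f \<longleftrightarrow> (\<forall>X Y Z. f (br X Y) Z = f X (br Y Z))"

text \<open>
  The form \<open>x\<^sub>0 B|k\<^sub>0 + \<dots> + x\<^sub>s B|k\<^sub>s + B|G\<^sub>1\<close>, where each restriction is extended by zero to the
  other summands of \<open>k\<^sub>0 \<oplus> \<dots> \<oplus> k\<^sub>s \<oplus> G\<^sub>1\<close>.
\<close>

definition rescaled_form ::
  "(bit \<Rightarrow> 'a::real_vector set) \<Rightarrow> nat \<Rightarrow> (nat \<Rightarrow> 'a set) \<Rightarrow> (nat \<Rightarrow> real) \<Rightarrow>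
   ('a \<Rightarrow> 'a \<Rightarrow> real) \<Rightarrow> 'a \<Rightarrow> 'a \<Rightarrow> real" where
  "rescaled_form G s k x B X Y =
     (\<Sum>i\<le>s. x i * B (component {..s} k i (component UNIV G 0 X))
                     (component {..s} k i (component UNIV G 0 Y)))
     + B (component UNIV G 1 X) (component UNIV G 1 Y)"

definition is_levi_civita ::
  "(bit \<Rightarrow> 'a::real_vector set) \<Rightarrow> ('a \<Rightarrow> 'a \<Rightarrow> 'a) \<Rightarrow> ('a \<Rightarrow> 'a \<Rightarrow> real) \<Rightarrow>
   ('a \<Rightarrow> 'a \<Rightarrow> 'a) \<Rightarrow> bool" where
  "is_levi_civita G br g nabla \<longleftrightarrow>
     bilinear nabla \<and>
     (\<forall>p q. \<forall>X\<in>G p. \<forall>Y\<in>G q. nabla X Y \<in> G (p + q)) \<and>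
     (\<forall>p q r. \<forall>X\<in>G p. \<forall>Y\<in>G q. \<forall>Z\<in>G r.
        g (nabla X Y) Z + koszul_sign p q * g Y (nabla X Z) = 0) \<and>
     (\<forall>p q. \<forall>X\<in>G p. \<forall>Y\<in>G q.
        nabla X Y - koszul_sign p q *\<^sub>R nabla Y X = br X Y)"

definition levi_civita ::
  "(bit \<Rightarrow> 'a::real_vector set) \<Rightarrow> ('a \<Rightarrow> 'a \<Rightarrow> 'a) \<Rightarrow> ('a \<Rightarrow> 'a \<Rightarrow> real) \<Rightarrow>
   'a \<Rightarrow> 'a \<Rightarrow> 'a" where
  "levi_civita G br g = (THE nabla. is_levi_civita G br g nabla)"

end

theory Submission
  imports Defs
begin

text \<open>
  Write the rescaled metric as \<open>B (M X) Y\<close>, where \<open>M\<close> is multiplication by \<open>x i\<close> on \<open>k i\<close> and the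
  identity on the odd part. The summands \<open>k i\<close> are \<open>B\<close>-orthogonal because simple ideals are perfect,
  so \<open>M\<close> is \<open>B\<close>-self-adjoint, and it commutes with the adjoint action of the even part because the
  \<open>k i\<close> are ideals. With these two facts the claimed formula is seen to be metric and torsion free.
  It is therefore the Levi-Civita connection: the difference of two connections is supersymmetric in
  its first two arguments and skew in the last two, hence zero.
\<close>

section \<open>Components in a direct sum\<close>

text \<open>Two candidates differ by an element of \<open>W i\<close> that lies in the span of the
  other summands, so they coincide. Every later fact about components is proved by exhibiting a
  candidate.\<close>

lemma component_unique:
  assumes "direct_sum_of V I W" "i \<in> I" "u \<in> W i" "v - u \<in> span (\<Union>j\<in>I - {i}. W j)"
  shows "component I W i v = u"
  unfolding component_def
proof (rule the_equality)
  fix w assume w: "w \<in> W i \<and> v - w \<in> span (\<Union>j\<in>I - {i}. W j)"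
  have "(v - w) - (v - u) \<in> span (\<Union>j\<in>I - {i}. W j)"
    using w assms(4) by (blast intro: span_diff)
  moreover have "u - w \<in> W i"
    using w assms by (auto simp: direct_sum_of_def intro: subspace_diff)
  ultimately have "u - w \<in> W i \<inter> span (\<Union>j\<in>I - {i}. W j)" by simp
  then have "u - w = 0" using assms(1,2) unfolding direct_sum_of_def by blast
  then show "w = u" by simp
qed (use assms in simp)

lemma component_exists:
  assumes "direct_sum_of V I W" "i \<in> I" "v \<in> V"
  shows "\<exists>u\<in>W i. v - u \<in> span (\<Union>j\<in>I - {i}. W j)"
proof -
  have "(\<Union>j\<in>I. W j) = W i \<union> (\<Union>j\<in>I - {i}. W j)" using assms(2) by auto
  then have "v \<in> span (W i \<union> (\<Union>j\<in>I - {i}. W j))"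
    using assms unfolding direct_sum_of_def by simp
  then obtain a b where "v = a + b" "a \<in> span (W i)" "b \<in> span (\<Union>j\<in>I - {i}. W j)"
    unfolding span_Un by blast
  moreover have "span (W i) = W i"
    using assms by (simp add: direct_sum_of_def span_eq_iff)
  ultimately show ?thesis by (intro bexI[of _ a]) auto
qed

lemma
  assumes "direct_sum_of V I W" "i \<in> I" "v \<in> V"
  shows component_in: "component I W i v \<in> W i"
    and diff_component_in: "v - component I W i v \<in> span (\<Union>j\<in>I - {i}. W j)"
  using component_exists[OF assms] component_unique[OF assms(1,2)] by metis+

lemma component_add:
  assumes "direct_sum_of V I W" "i \<in> I" "v \<in> V" "w \<in> V"
  shows "component I W i (v + w) = component I W i v + component I W i w"
proof (rule component_unique[OF assms(1,2)])
  show "component I W i v + component I W i w \<in> W i"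
    using assms by (meson component_in direct_sum_of_def subspace_add)
  have "(v - component I W i v) + (w - component I W i w) \<in> span (\<Union>j\<in>I - {i}. W j)"
    using assms by (intro span_add diff_component_in)
  then show "v + w - (component I W i v + component I W i w) \<in> span (\<Union>j\<in>I - {i}. W j)"
    by (simp add: algebra_simps)
qed

lemma component_scale:
  assumes "direct_sum_of V I W" "i \<in> I" "v \<in> V"
  shows "component I W i (c *\<^sub>R v) = c *\<^sub>R component I W i v"
proof (rule component_unique[OF assms(1,2)])
  show "c *\<^sub>R component I W i v \<in> W i"
    using assms by (meson component_in direct_sum_of_def subspace_scale)
  have "c *\<^sub>R (v - component I W i v) \<in> span (\<Union>j\<in>I - {i}. W j)"
    using assms by (intro span_scale diff_component_in)
  then show "c *\<^sub>R v - c *\<^sub>R component I W i v \<in> span (\<Union>j\<in>I - {i}. W j)"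
    by (simp add: algebra_simps)
qed

lemma component_same:
  assumes "direct_sum_of V I W" "i \<in> I" "v \<in> W i"
  shows "component I W i v = v"
  using assms by (intro component_unique) (auto simp: span_zero)

lemma component_other:
  assumes "direct_sum_of V I W" "i \<in> I" "j \<in> I" "i \<noteq> j" "v \<in> W j"
  shows "component I W i v = 0"
  using assms
  by (intro component_unique) (auto simp: direct_sum_of_def subspace_0 intro: span_base)

section \<open>Rescaled metrics\<close>

lemma bilinearI:
  assumes "\<And>a b c. f (a + b) c = f a c + f b c" "\<And>a b c. f a (b + c) = f a b + f a c"
    "\<And>r a b. f (r *\<^sub>R a) b = r *\<^sub>R f a b" "\<And>r a b. f a (r *\<^sub>R b) = r *\<^sub>R f a b"
  shows "bilinear f"
  using assms by (simp add: bilinear_def linear_iff)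

lemma bit_pair_cases:
  fixes p q :: bit
  obtains "p = 0" "q = 0" | "p = 0" "q = 1" | "p = 1" "q = 0" | "p = 1" "q = 1"
  by (metis bit_not_one_iff)

locale rescaled_superalgebra = lie_superalgebra G br
  for G :: "bit \<Rightarrow> 'a::real_vector set" and br +
  fixes s :: nat and k :: "nat \<Rightarrow> 'a set" and B :: "'a \<Rightarrow> 'a \<Rightarrow> real" and x :: "nat \<Rightarrow> real"
  assumes even_sum: "direct_sum_of (G 0) {..s} k"
    and ideals: "i \<le> s \<Longrightarrow> lie_ideal br (G 0) (k i)"
    and simple: "i \<in> {1..s} \<Longrightarrow> lie_simple br (k i)"
    and metric: "super_metric G B"
    and invariant: "bi_invariant br B"
    and x_nz: "i \<le> s \<Longrightarrow> x i \<noteq> 0"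
begin

section \<open>Grading projections and generators\<close>

abbreviation P where "P \<equiv> component UNIV G 0"
abbreviation Q where "Q \<equiv> component UNIV G 1"

lemma P_simps [simp]: "P (u + v) = P u + P v" "P (c *\<^sub>R u) = c *\<^sub>R P u" "P u \<in> G 0"
  by (simp_all add: component_add[OF grading] component_scale[OF grading] component_in[OF grading])

lemma Q_simps [simp]: "Q (u + v) = Q u + Q v" "Q (c *\<^sub>R u) = c *\<^sub>R Q u" "Q u \<in> G 1"
  by (simp_all add: component_add[OF grading] component_scale[OF grading] component_in[OF grading])

lemma PQ_hom [simp]:
  "u \<in> G 0 \<Longrightarrow> P u = u" "u \<in> G 1 \<Longrightarrow> P u = 0" "u \<in> G 0 \<Longrightarrow> Q u = 0" "u \<in> G 1 \<Longrightarrow> Q u = u"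
  by (auto intro: component_same[OF grading] component_other[OF grading])

lemma subspace_G: "subspace (G p)"
  using grading by (simp add: direct_sum_of_def)

lemma hom_span: "span (G 0 \<union> G 1) = UNIV"
proof -
  have "(UNIV :: bit set) = {0, 1}" by (metis (full_types) UNIV_eq_I bit_not_one_iff insert_iff)
  then have "(\<Union>p\<in>UNIV. G p) = \<Union> (G ` {0, 1})" by (rule arg_cong)
  then show ?thesis using grading by (simp add: direct_sum_of_def)
qed

lemma k_even: "i \<le> s \<Longrightarrow> X \<in> k i \<Longrightarrow> X \<in> G 0"
  using ideals by (auto simp: lie_ideal_def)

lemma even_span: "span (\<Union>i\<le>s. k i) = G 0"
  using even_sum by (simp add: direct_sum_of_def)

text \<open>These generators are finer than the homogeneous elements: on each of them
  \<open>M\<close>, introduced below, acts by a scalar.\<close>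

lemma hom_span_k: "span ((\<Union>i\<le>s. k i) \<union> G 1) = UNIV"
proof -
  have "G 0 \<union> G 1 \<subseteq> span ((\<Union>i\<le>s. k i) \<union> G 1)"
    using span_mono[of "\<Union>i\<le>s. k i" "(\<Union>i\<le>s. k i) \<union> G 1"] by (auto simp: even_span intro: span_base)
  then have "span (G 0 \<union> G 1) \<subseteq> span ((\<Union>i\<le>s. k i) \<union> G 1)"
    by (simp add: span_minimal)
  then show ?thesis using hom_span by auto
qed

section \<open>Calculus of the bracket and of the form\<close>

lemma br_simps [simp]:
  "br (u + v) w = br u w + br v w" "br u (v + w) = br u v + br u w"
  "br (c *\<^sub>R u) v = c *\<^sub>R br u v" "br u (c *\<^sub>R v) = c *\<^sub>R br u v"
  "br 0 u = 0" "br u 0 = 0" "br (u - v) w = br u w - br v w" "br u (v - w) = br u v - br u w"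
  using bilinear_br
  by (auto simp: bilinear_ladd bilinear_radd bilinear_lmul bilinear_rmul bilinear_lzero
      bilinear_rzero bilinear_lsub bilinear_rsub)

lemma bilinear_B: "bilinear B"
  using metric unfolding super_metric_def by blast

lemma B_simps [simp]:
  "B (u + v) w = B u w + B v w" "B u (v + w) = B u v + B u w"
  "B (c *\<^sub>R u) v = c * B u v" "B u (c *\<^sub>R v) = c * B u v"
  "B 0 u = 0" "B u 0 = 0" "B (- u) v = - B u v" "B u (- v) = - B u v"
  "B (u - v) w = B u w - B v w" "B u (v - w) = B u v - B u w"
  using bilinear_B
  by (auto simp: bilinear_ladd bilinear_radd bilinear_lmul bilinear_rmul bilinear_lzero
      bilinear_rzero bilinear_lsub bilinear_rsub bilinear_lneg bilinear_rneg)

lemma B_super: "X \<in> G p \<Longrightarrow> Y \<in> G q \<Longrightarrow> B X Y = koszul_sign p q * B Y X"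
  using metric unfolding super_metric_def by blast

lemma B_even_odd [simp]: "X \<in> G 0 \<Longrightarrow> Y \<in> G 1 \<Longrightarrow> B X Y = 0"
  using metric unfolding super_metric_def by blast

lemma B_odd_even [simp]: "X \<in> G 1 \<Longrightarrow> Y \<in> G 0 \<Longrightarrow> B X Y = 0"
  by (subst B_super[of X 1 Y 0]) auto

lemma B_nondegenerate: "(\<And>Y. B X Y = 0) \<Longrightarrow> X = 0"
  using metric unfolding super_metric_def by blast

lemma B_br: "B (br X Y) Z = B X (br Y Z)"
  using invariant by (simp add: bi_invariant_def)

section \<open>Brackets and orthogonality of the ideals\<close>

lemma br_even_skew: "X \<in> G 0 \<Longrightarrow> Y \<in> G q \<Longrightarrow> br X Y = - br Y X"
  using super_skew[of X 0 Y q] by (simp add: koszul_sign_def)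

lemma br_odd_sym: "X \<in> G 1 \<Longrightarrow> Y \<in> G 1 \<Longrightarrow> br X Y = br Y X"
  using super_skew[of X 1 Y 1] by (simp add: koszul_sign_def)

lemma B_ad_even:
  assumes "X \<in> G 0" "Y \<in> G q"
  shows "B (br X Y) Z = - B Y (br X Z)"
  using br_even_skew[OF assms] by (simp add: B_br)

text \<open>Both summands are ideals of \<open>G 0\<close>, so the bracket lies in
  \<open>k i\<close> and in \<open>k j\<close>, which meet only in 0.\<close>

lemma br_k_distinct:
  assumes "i \<le> s" "j \<le> s" "i \<noteq> j" "X \<in> k i" "Y \<in> k j"
  shows "br X Y = 0"
proof -
  have "br X Y \<in> k j"
    using ideals[OF assms(2)] k_even assms by (auto simp: lie_ideal_def)
  moreover have "- br Y X \<in> k i"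
    using ideals[OF assms(1)] k_even assms by (auto simp: lie_ideal_def intro: subspace_neg)
  then have "br X Y \<in> k i" using br_even_skew[of X Y 0] k_even assms by simp
  \<comment> \<open>The trivial intersection enters through components: the \<open>i\<close>-th
    component of the bracket is the bracket itself and also 0.\<close>
  ultimately show ?thesis
    using component_same[OF even_sum, of i "br X Y"] component_other[OF even_sum, of i j "br X Y"]
      assms(1-3) by simp
qed

text \<open>The derived algebra is an ideal of \<open>k i\<close>, and it is nonzero because
  \<open>k i\<close> is not Abelian; simplicity leaves only \<open>k i\<close>.\<close>

lemma simple_perfect:
  assumes "i \<in> {1..s}"
  shows "span {br X Y | X Y. X \<in> k i \<and> Y \<in> k i} = k i" (is "span ?S = _")
proof -
  have i: "i \<le> s" using assms by simp
  have "subspace (k i)" "?S \<subseteq> k i"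
    using ideals[OF i] k_even[OF i] unfolding lie_ideal_def by blast+
  then have le: "span ?S \<subseteq> k i" by (simp add: span_minimal)
  \<comment> \<open>By \<open>le\<close> the element \<open>Y\<close> lies in \<open>k i\<close>, so
    \<open>br X Y\<close> is itself one of the generators.\<close>
  have "br X Y \<in> span ?S" if "X \<in> k i" "Y \<in> span ?S" for X Y
    by (rule span_base) (use le that in blast)
  then have "lie_ideal br (k i) (span ?S)"
    using le by (simp add: lie_ideal_def)
  then have "span ?S = {0} \<or> span ?S = k i"
    using simple[OF assms] unfolding lie_simple_def by blast
  moreover have "span ?S \<noteq> {0}"
  proof
    assume "span ?S = {0}"
    then have "?S \<subseteq> {0}" using span_superset[of ?S] by (simp only:)
    then have "lie_abelian br (k i)" unfolding lie_abelian_def by blast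
    then show False using simple[OF assms] unfolding lie_simple_def by blast
  qed
  ultimately show ?thesis by blast
qed

text \<open>For a generator of the perfect ideal \<open>k i\<close>, invariance gives B([U,V],Y) =
  B(U,[V,Y]), and [V,Y] = 0 for distinct ideals.\<close>

lemma B_orth_simple:
  assumes "i \<in> {1..s}" "j \<le> s" "i \<noteq> j" "X \<in> k i" "Y \<in> k j"
  shows "B X Y = 0"
proof -
  have "linear (\<lambda>u. B u Y)" by (simp add: linear_iff)
  moreover have "X \<in> span {br U V | U V. U \<in> k i \<and> V \<in> k i}"
    using simple_perfect assms by simp
  moreover have "B u Y = 0" if "u \<in> {br U V | U V. U \<in> k i \<and> V \<in> k i}" for u
    using that assms br_k_distinct[of i j] by (auto simp: B_br)
  ultimately show ?thesis using linear_eq_0_on_span by blast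
qed

text \<open>At most one of two distinct indices is 0, so one of the ideals is simple; symmetry of
  \<open>B\<close> on the even part covers the case i = 0.\<close>

lemma B_orth:
  assumes "i \<le> s" "j \<le> s" "i \<noteq> j" "X \<in> k i" "Y \<in> k j"
  shows "B X Y = 0"
proof (cases "i = 0")
  case True
  then have "B Y X = 0" using assms by (intro B_orth_simple[of j i]) auto
  then show ?thesis using B_super[of X 0 Y 0] k_even assms by simp
qed (use assms B_orth_simple[of i j] in auto)

section \<open>The rescaling operator\<close>

definition M where "M u = (\<Sum>i\<le>s. x i *\<^sub>R component {..s} k i (P u)) + Q u"

lemma kcomp_simps [simp]:
  assumes "i \<le> s"
  shows "component {..s} k i (P u + P v) = component {..s} k i (P u) + component {..s} k i (P v)"
    "component {..s} k i (c *\<^sub>R P u) = c *\<^sub>R component {..s} k i (P u)"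
  using component_add[OF even_sum] component_scale[OF even_sum] assms by auto

lemma kcomp_k:
  assumes "i \<le> s" "j \<le> s" "X \<in> k j"
  shows "component {..s} k i X = (if i = j then X else 0)"
  using component_same[OF even_sum, of i X] component_other[OF even_sum, of i j X] assms by auto

lemma kcomp_zero: "i \<le> s \<Longrightarrow> component {..s} k i 0 = 0"
  using component_scale[OF even_sum, of i 0 0] subspace_G[of 0] by (simp add: subspace_0)

lemma M_simps [simp]: "M (u + v) = M u + M v" "M (c *\<^sub>R u) = c *\<^sub>R M u"
  by (auto simp: M_def algebra_simps scaleR_sum_right sum.distrib)

lemma linear_M: "linear M"
  by (simp add: linear_iff)

lemma M_k:
  assumes "i \<le> s" "X \<in> k i"
  shows "M X = x i *\<^sub>R X"
proof -
  have "(\<Sum>j\<le>s. x j *\<^sub>R component {..s} k j X) = (\<Sum>j\<le>s. if j = i then x i *\<^sub>R X else 0)"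
    using assms by (intro sum.cong) (auto simp: kcomp_k)
  then show ?thesis using assms k_even[OF assms] by (simp add: M_def)
qed

lemma M_odd [simp]: "X \<in> G 1 \<Longrightarrow> M X = X"
  by (simp add: M_def kcomp_zero)

lemma M_even [simp]:
  assumes "X \<in> G 0"
  shows "M X \<in> G 0"
  unfolding M_def using assms component_in[OF even_sum, of _ X] k_even
  by (auto intro!: subspace_sum subspace_scale subspace_G)

lemma linear_components: "linear P" "linear Q"
  by (simp_all add: linear_iff)

lemma bilinear_eq_on_generators:
  assumes "bilinear f" "bilinear g"
    and "\<And>X Y. X \<in> (\<Union>i\<le>s. k i) \<union> G 1 \<Longrightarrow> Y \<in> (\<Union>i\<le>s. k i) \<union> G 1 \<Longrightarrow> f X Y = g X Y"
  shows "f X Y = g X Y"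
  by (rule bilinear_eq[OF assms(1,2) equalityD2[OF hom_span_k] equalityD2[OF hom_span_k]])
    (use assms(3) in auto)

lemma M_self_adjoint: "B (M X) Y = B X (M Y)"
proof (rule bilinear_eq_on_generators[of "\<lambda>X Y. B (M X) Y" "\<lambda>X Y. B X (M Y)"])
  fix X Y assume "X \<in> (\<Union>i\<le>s. k i) \<union> G 1" "Y \<in> (\<Union>i\<le>s. k i) \<union> G 1"
  then consider i j where "i \<le> s" "j \<le> s" "X \<in> k i" "Y \<in> k j"
    | i where "i \<le> s" "X \<in> k i" "Y \<in> G 1" | i where "i \<le> s" "Y \<in> k i" "X \<in> G 1"
    | "X \<in> G 1" "Y \<in> G 1" by blast
  then show "B (M X) Y = B X (M Y)"
  proof cases
    case (1 i j)
    then show ?thesis using B_orth[of i j X Y] by (cases "i = j") (auto simp: M_k)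
  qed (auto simp: k_even)
qed (rule bilinearI; simp)+

text \<open>For \<open>Y\<close> in \<open>k i\<close> the bracket stays in the ideal
  \<open>k i\<close>, where \<open>M\<close> is the same scalar before and after bracketing with
  \<open>X\<close>.\<close>

lemma M_br_even:
  assumes "X \<in> G 0" "Y \<in> G 0"
  shows "M (br X Y) = br X (M Y)"
proof (rule linear_eq_on_span[of "\<lambda>Y. M (br X Y)" "\<lambda>Y. br X (M Y)"])
  show "Y \<in> span (\<Union>i\<le>s. k i)" using assms even_span by simp
  fix Y assume "Y \<in> (\<Union>i\<le>s. k i)"
  then obtain i where i: "i \<le> s" "Y \<in> k i" by blast
  then have "br X Y \<in> k i" using ideals assms by (auto simp: lie_ideal_def)
  then show "M (br X Y) = br X (M Y)" using i by (simp add: M_k)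
qed (simp_all add: linear_iff)

text \<open>This replaces the sum over components by one expression in \<open>B\<close>, to which
  invariance applies directly.\<close>

lemma rescaled_form_eq: "rescaled_form G s k x B X Y = B (M X) Y"
proof (rule bilinear_eq_on_generators[of _ "\<lambda>X Y. B (M X) Y"])
  show "bilinear (rescaled_form G s k x B)"
    unfolding rescaled_form_def
    by (rule bilinearI) (auto simp: algebra_simps sum.distrib sum_distrib_left)
  show "bilinear (\<lambda>X Y. B (M X) Y)" by (rule bilinearI) simp_all
  fix X Y assume "X \<in> (\<Union>i\<le>s. k i) \<union> G 1" "Y \<in> (\<Union>i\<le>s. k i) \<union> G 1"
  then consider i j where "i \<le> s" "j \<le> s" "X \<in> k i" "Y \<in> k j"
    | i where "i \<le> s" "X \<in> k i" "Y \<in> G 1" | i where "i \<le> s" "Y \<in> k i" "X \<in> G 1"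
    | "X \<in> G 1" "Y \<in> G 1" by blast
  then show "rescaled_form G s k x B X Y = B (M X) Y"
  proof cases
    case (1 i j)
    \<comment> \<open>Only l = i can contribute, and only when i = j; for distinct indices the
      right-hand side is 0 as well, by orthogonality.\<close>
    have "(\<Sum>l\<le>s. x l * B (component {..s} k l X) (component {..s} k l Y)) =
      (\<Sum>l\<le>s. if l = i then x i * B X Y else 0)"
      using 1 B_orth[of i j X Y] by (intro sum.cong) (auto simp: kcomp_k)
    then show ?thesis using 1 k_even[of i X] k_even[of j Y] by (simp add: rescaled_form_def M_k)
  qed (auto simp: rescaled_form_def kcomp_zero k_even M_k)
qed

text \<open>Self-adjointness moves \<open>M\<close> onto a generator, where it is a nonzero scalar;
  this reduces the claim to non-degeneracy of \<open>B\<close>.\<close>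

lemma M_nondegenerate:
  assumes "\<And>Y. B (M X) Y = 0"
  shows "X = 0"
proof (rule B_nondegenerate)
  fix Y
  have "linear (B X)" by (simp add: linear_iff)
  moreover have "Y \<in> span ((\<Union>i\<le>s. k i) \<union> G 1)" by (simp add: hom_span_k)
  moreover have "B X Z = 0" if "Z \<in> (\<Union>i\<le>s. k i) \<union> G 1" for Z
    using that
  proof
    assume "Z \<in> (\<Union>i\<le>s. k i)"
    then obtain i where i: "i \<le> s" "Z \<in> k i" by blast
    have "B (M X) Z = x i * B X Z" using i by (simp add: M_self_adjoint M_k)
    then show ?thesis using assms x_nz i by simp
  next
    assume "Z \<in> G 1"
    then show ?thesis using assms[of Z] by (simp add: M_self_adjoint)
  qed
  ultimately show "B X Y = 0" using linear_eq_0_on_span by blast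
qed

section \<open>The Levi-Civita connection\<close>

text \<open>The terms are the four parity blocks. Writing \<open>M\<close> instead of the numbers
  \<open>x i\<close> makes the formula bilinear on the whole space. Vanishing torsion suggests half
  the bracket on odd pairs; metric compatibility then dictates the odd-even block, and torsion the
  even-odd one.\<close>

definition conn where
  "conn X Y = (1/2) *\<^sub>R br (P X) (P Y) + (1/2) *\<^sub>R br (Q X) (Q Y)
     + br (P X - (1/2) *\<^sub>R M (P X)) (Q Y) + (1/2) *\<^sub>R br (Q X) (M (P Y))"

lemma zero_simps [simp]: "P 0 = 0" "Q 0 = 0" "M 0 = 0"
  using linear_components linear_M by (simp_all add: linear_0)

lemma conn_hom:
  "X \<in> G 0 \<Longrightarrow> Y \<in> G 0 \<Longrightarrow> conn X Y = (1/2) *\<^sub>R br X Y"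
  "X \<in> G 1 \<Longrightarrow> Y \<in> G 1 \<Longrightarrow> conn X Y = (1/2) *\<^sub>R br X Y"
  "X \<in> G 0 \<Longrightarrow> Y \<in> G 1 \<Longrightarrow> conn X Y = br X Y - (1/2) *\<^sub>R br (M X) Y"
  "X \<in> G 1 \<Longrightarrow> Y \<in> G 0 \<Longrightarrow> conn X Y = (1/2) *\<^sub>R br X (M Y)"
  by (simp_all add: conn_def)

lemma br_degree_simps [simp]:
  "X \<in> G 0 \<Longrightarrow> Y \<in> G 0 \<Longrightarrow> br X Y \<in> G 0" "X \<in> G 1 \<Longrightarrow> Y \<in> G 1 \<Longrightarrow> br X Y \<in> G 0"
  "X \<in> G 0 \<Longrightarrow> Y \<in> G 1 \<Longrightarrow> br X Y \<in> G 1" "X \<in> G 1 \<Longrightarrow> Y \<in> G 0 \<Longrightarrow> br X Y \<in> G 1"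
  using br_degree[of X 0 Y 0] br_degree[of X 1 Y 1] br_degree[of X 0 Y 1] br_degree[of X 1 Y 0]
  by simp_all

lemma conn_degree:
  assumes "X \<in> G p" "Y \<in> G q"
  shows "conn X Y \<in> G (p + q)"
  using assms
  by (cases p q rule: bit_pair_cases)
    (auto simp: conn_hom intro!: subspace_scale subspace_diff subspace_G)

lemma conn_torsion_free:
  assumes "X \<in> G p" "Y \<in> G q"
  shows "conn X Y - koszul_sign p q *\<^sub>R conn Y X = br X Y"
proof (cases p q rule: bit_pair_cases)
  case 1
  then show ?thesis using assms br_even_skew[of Y X 0]
    by (simp add: conn_hom koszul_sign_def flip: scaleR_left_distrib)
next
  \<comment> \<open>The two terms containing \<open>M\<close> cancel, since \<open>M X\<close> is
    even and its bracket with \<open>Y\<close> is skew. The next case is the mirror image.\<close>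
  case 2
  then show ?thesis using assms br_even_skew[of "M X" Y 1] by (simp add: conn_hom koszul_sign_def)
next
  case 3
  then show ?thesis using assms br_even_skew[of Y X 1] br_even_skew[of "M Y" X 1]
    by (simp add: conn_hom koszul_sign_def)
next
  case 4
  then show ?thesis using assms br_odd_sym[of X Y]
    by (simp add: conn_hom koszul_sign_def flip: scaleR_left_distrib)
qed

lemma conn_metric:
  assumes X: "X \<in> G p" and Y: "Y \<in> G q" and Z: "Z \<in> G r"
  shows "B (M (conn X Y)) Z + koszul_sign p q * B (M Y) (conn X Z) = 0"
proof (cases "p + q + r = 0")
  case False
  \<comment> \<open>When the total degree is odd, each pairing is between elements of opposite
    parity, so both terms vanish.\<close>
  then consider "p + q = 0" "r = 1" "q = 0" "p + r = 1" | "p + q = 0" "r = 1" "q = 1" "p + r = 0"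
    | "p + q = 1" "r = 0" "q = 0" "p + r = 1" | "p + q = 1" "r = 0" "q = 1" "p + r = 0"
    by (cases p q rule: bit_pair_cases; cases "r = 0") auto
  then show ?thesis
    using conn_degree[OF X Y] conn_degree[OF X Z] Y Z by cases auto
next
  case True
  then consider "p = 0" "q = 0" "r = 0" | "p = 0" "q = 1" "r = 1"
    | "p = 1" "q = 0" "r = 1" | "p = 1" "q = 1" "r = 0"
    by (cases p q rule: bit_pair_cases; cases "r = 0") auto
  then show ?thesis
  proof cases
    \<comment> \<open>\<open>M\<close> commutes with the bracket by \<open>X\<close>, and that
      bracket is \<open>B\<close>-skew.\<close>
    case 1
    then show ?thesis using assms B_ad_even[of X "M Y" 0 Z]
      by (simp add: conn_hom koszul_sign_def M_br_even)
  next
    \<comment> \<open>Here \<open>M\<close> is the identity on all odd entries, and bracketing with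
      either of the even elements \<open>X\<close> and \<open>M X\<close> is
      \<open>B\<close>-skew.\<close>
    case 2
    then show ?thesis using assms B_ad_even[of X Y 1 Z] B_ad_even[of "M X" Y 1 Z] conn_degree[OF X Y]
      by (simp add: conn_hom koszul_sign_def)
  next
    \<comment> \<open>The first term is half of B([X,MY],Z) = -B([MY,X],Z) = -B(MY,[X,Z]), which
      cancels the second.\<close>
    case 3
    then show ?thesis using assms B_br[of "M Y" X Z] br_even_skew[of "M Y" X 1] conn_degree[OF X Y]
      by (simp add: conn_hom koszul_sign_def)
  next
    \<comment> \<open>Self-adjointness moves \<open>M\<close> onto \<open>Z\<close>; then
      B([X,Y],MZ) = B([Y,X],MZ) = B(Y,[X,MZ]), and the Koszul sign is -1.\<close>
    case 4
    then show ?thesis using assms B_br[of Y X "M Z"] br_odd_sym[of X Y]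
      by (simp add: conn_hom koszul_sign_def M_self_adjoint)
  qed
qed

lemma is_levi_civita_conn: "is_levi_civita G br (rescaled_form G s k x B) conn"
proof -
  have "bilinear conn"
    by (rule bilinearI) (simp_all add: conn_def algebra_simps)
  then show ?thesis
    unfolding is_levi_civita_def rescaled_form_eq
    using conn_degree conn_metric conn_torsion_free by auto
qed

section \<open>Uniqueness of the connection\<close>

lemma rescaled_super:
  assumes "X \<in> G p" "Y \<in> G q"
  shows "B (M X) Y = koszul_sign p q * B (M Y) X"
proof -
  have "M X \<in> G p" using assms by (cases "p = 0") auto
  then show ?thesis using assms B_super[of "M X" p Y q] by (simp add: M_self_adjoint)
qed

lemma levi_civita_unique:
  assumes "is_levi_civita G br (rescaled_form G s k x B) n1"
    and "is_levi_civita G br (rescaled_form G s k x B) n2"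
  shows "n1 = n2"
proof -
  define D where "D X Y = n1 X Y - n2 X Y" for X Y
  have bl: "bilinear n1" "bilinear n2" using assms by (auto simp: is_levi_civita_def)
  have deg: "D X Y \<in> G (p + q)" if "X \<in> G p" "Y \<in> G q" for X Y p q
    unfolding D_def
  proof (rule subspace_diff[OF subspace_G])
    show "n1 X Y \<in> G (p + q)" "n2 X Y \<in> G (p + q)"
      using assms[unfolded is_levi_civita_def, THEN conjunct2, THEN conjunct1, rule_format, OF that]
      by simp_all
  qed
  have tor: "D X Y = koszul_sign p q *\<^sub>R D Y X" if "X \<in> G p" "Y \<in> G q" for X Y p q
  proof -
    have "n1 X Y - koszul_sign p q *\<^sub>R n1 Y X = n2 X Y - koszul_sign p q *\<^sub>R n2 Y X"
      using assms that unfolding is_levi_civita_def by metis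
    then show ?thesis by (simp add: D_def algebra_simps)
  qed
  have linM: "M (u - v) = M u - M v" for u v
    using linear_M by (simp add: linear_diff)
  have met: "B (M (D X Y)) Z = - koszul_sign q r * B (M (D X Z)) Y"
    if "X \<in> G p" "Y \<in> G q" "Z \<in> G r" for X Y Z p q r
  proof -
    have "B (M (n1 X Y)) Z + koszul_sign p q * B (M Y) (n1 X Z) = 0"
      "B (M (n2 X Y)) Z + koszul_sign p q * B (M Y) (n2 X Z) = 0"
      using assms that unfolding is_levi_civita_def rescaled_form_eq by blast+
    then have "B (M (D X Y)) Z = - koszul_sign p q * B (M Y) (D X Z)"
      by (simp add: D_def linM algebra_simps)
    \<comment> \<open>\<open>D X Z\<close> has degree p + r. The signs for (p,q) and (q,p+r)
      multiply to the sign for (q,r), because the Koszul sign is multiplicative in each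
      degree.\<close>
    also have "\<dots> = - koszul_sign p q * (koszul_sign q (p + r) * B (M (D X Z)) Y)"
      using rescaled_super[OF that(2) deg[OF that(1,3)]] by simp
    finally show ?thesis by (auto simp: koszul_sign_def split: if_splits)
  qed
  have T0: "B (M (D X Y)) Z = 0" if h: "X \<in> G p" "Y \<in> G q" "Z \<in> G r" for X Y Z p q r
  proof -
    let ?T = "\<lambda>X Y Z. B (M (D X Y)) Z"
    have sw: "?T U V W = koszul_sign a b * ?T V U W" if "U \<in> G a" "V \<in> G b" for U V W a b
      using tor[OF that] by simp
    \<comment> \<open>Alternating the two symmetries runs through all six orderings and returns to
      the start. Each Koszul sign occurs twice and the minus sign three times, so the value equals
      its own negative.\<close>
    have "?T X Y Z = - koszul_sign q r * ?T X Z Y" by (rule met[OF h])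
    moreover have "?T X Z Y = koszul_sign p r * ?T Z X Y" by (rule sw[OF h(1,3)])
    moreover have "?T Z X Y = - koszul_sign p q * ?T Z Y X" by (rule met[OF h(3,1,2)])
    moreover have "?T Z Y X = koszul_sign r q * ?T Y Z X" by (rule sw[OF h(3,2)])
    moreover have "?T Y Z X = - koszul_sign r p * ?T Y X Z" by (rule met[OF h(2,3,1)])
    moreover have "?T Y X Z = koszul_sign q p * ?T X Y Z" by (rule sw[OF h(2,1)])
    ultimately show ?thesis
      by (auto simp: koszul_sign_def split: if_splits)
  qed
  have "D X Y = 0" if h: "X \<in> G p" "Y \<in> G q" for X Y p q
  proof (rule M_nondegenerate)
    fix Z
    have "linear (B (M (D X Y)))" by (simp add: linear_iff)
    moreover have "Z \<in> span (G 0 \<union> G 1)" by (simp add: hom_span)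
    ultimately show "B (M (D X Y)) Z = 0"
      using linear_eq_0_on_span T0[OF h] by blast
  qed
  then have "n1 X Y = n2 X Y" if "X \<in> G 0 \<union> G 1" "Y \<in> G 0 \<union> G 1" for X Y
    using that unfolding D_def by fastforce
  \<comment> \<open>Homogeneous elements span, so bilinearity extends the equality to all
    arguments.\<close>
  then have "n1 X Y = n2 X Y" for X Y
    using bilinear_eq[OF bl equalityD2[OF hom_span] equalityD2[OF hom_span]] by blast
  then show ?thesis by blast
qed

lemma levi_civita_eq: "levi_civita G br (rescaled_form G s k x B) = conn"
  unfolding levi_civita_def using is_levi_civita_conn levi_civita_unique by blast

end

theorem lemma3p5:
  fixes G :: "bit \<Rightarrow> 'a::real_vector set"
    and br :: "'a \<Rightarrow> 'a \<Rightarrow> 'a"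
    and s :: nat
    and k :: "nat \<Rightarrow> 'a set"
    and B :: "'a \<Rightarrow> 'a \<Rightarrow> real"
    and x :: "nat \<Rightarrow> real"
    and nabla :: "'a \<Rightarrow> 'a \<Rightarrow> 'a"
  assumes "lie_superalgebra G br"
    and "lie_reductive br (G 0)"
    and "direct_sum_of (G 0) {..s} k"
    and "\<forall>i\<le>s. lie_ideal br (G 0) (k i)"
    and "lie_abelian br (k 0)"
    and "\<forall>i\<in>{1..s}. lie_simple br (k i)"
    and "super_metric G B"
    and "bi_invariant br B"
    and "\<forall>i\<le>s. x i \<noteq> 0"
    and "nabla = levi_civita G br (rescaled_form G s k x B)"
  shows "(\<forall>i\<le>s. \<forall>j\<le>s. \<forall>X\<in>k i. \<forall>Y\<in>k j. nabla X Y = (1 / 2) *\<^sub>R br X Y) \<and>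
         (\<forall>X\<in>G 1. \<forall>Y\<in>G 1. nabla X Y = (1 / 2) *\<^sub>R br X Y) \<and>
         (\<forall>i\<le>s. \<forall>X\<in>k i. \<forall>Y\<in>G 1. nabla X Y = (1 - x i / 2) *\<^sub>R br X Y) \<and>
         (\<forall>i\<le>s. \<forall>X\<in>G 1. \<forall>Y\<in>k i. nabla X Y = (x i / 2) *\<^sub>R br X Y)"
proof -
  interpret rescaled_superalgebra G br s k B x
    unfolding rescaled_superalgebra_def rescaled_superalgebra_axioms_def using assms by blast
  have "nabla = conn" using assms(10) levi_civita_eq by simp
  \<comment> \<open>On \<open>k i\<close> the operator \<open>M\<close> is the scalar
    \<open>x i\<close>, which turns the mixed blocks of \<open>conn\<close> into the coefficients 1
    - x i / 2 and x i / 2.\<close>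
  then show ?thesis
    by (auto simp: conn_hom k_even M_k algebra_simps)
qed

end
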